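(* Let $\alpha\in(0,1)$ and let $u_\alpha(k)$, $k\ge1$, be either the linear boundary $u_\alpha(k)=\sqrt{\frac{-\log\alpha}{2m}}\,k+\sqrt{\frac{-m\log\alpha}{2}}$ (for a fixed $m>0$) or the curved boundary $u_\alpha(k)=1.7\sqrt{k(\log\log(2k)+0.72\log\frac{5.2}{\alpha})}$. Suppose the $p$-values $(p_i)_{i\in\mathcal I}$ are independent and mirror-conservative. Then both versions of the adaptively ordered martingale test described below reject with probability at most $\alpha$: (Batch version, $\mathcal I=\{1,\dots,n\}$.) Set $M_0=\emptyset$ and for $k=1,\dots,n$ let $M_k=M_{k-1}\cup\{i_k\}$, where $i_k\in\arg\min_{i\notin M_{k-1}} g(p_i)$; reject if there exists $k\in\{1,\dots,n\}$ with $\sum_{i\in M_k}h(p_i)>u_\alpha(k)$. (Online version, $\mathcal I=\mathbb N$, with a fixed threshold parameter $c$.) Process $t=1,2,\dots$ in order; hypothesis $t$ is included into the current set $M$ (and the counter $k=|M|$ increases by one) if and only if $g(p_t)<c$; reject if at some time the current set $M$ with $k=|M|\ge1$ satisfies $\sum_{i\in M}h(p_i)>u_\alpha(k)$.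
   Context: For a $p$-value $p$ define the missing bit $h(p)=2\cdot\mathbf 1\{p<0.5\}-1\in\{-1,1\}$ and the masked $p$-value $g(p)=\min\{p,1-p\}$. A $p$-value $p_i$ with probability mass function (if discrete) or density (otherwise) $f_i$ is called mirror-conservative if $f_i(a)\le f_i(1-a)$ for all $0\le a\le 0.5$. These assumptions describe the global null hypothesis; the probability of rejection under them is the type-I error.
   Formalization: In the batch version, ties in the arg min of g(p_i) are broken by the smallest index; with a tie-breaking choice that may depend on the missing bits h(p_i), the claim fails for discrete p-values. *)

theory Defs
  imports "HOL-Probability.Probability"
begin

definition hbit :: "real \<Rightarrow> real" where
  "hbit p = (if p < 1/2 then 1 else -1)"

definition gmask :: "real \<Rightarrow> real" where
  "gmask p = min p (1 - p)"

definition mirror_conservative :: "'a measure \<Rightarrow> ('a \<Rightarrow> real) \<Rightarrow> bool" where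
  "mirror_conservative M X \<longleftrightarrow>
     X \<in> borel_measurable M \<and> (\<forall>\<omega>\<in>space M. 0 \<le> X \<omega> \<and> X \<omega> \<le> 1) \<and>
     ((\<exists>S. countable S \<and> (AE \<omega> in M. X \<omega> \<in> S) \<and>
         (\<forall>a. 0 \<le> a \<and> a \<le> 1/2 \<longrightarrow>
            measure M {\<omega>\<in>space M. X \<omega> = a} \<le> measure M {\<omega>\<in>space M. X \<omega> = 1 - a}))
      \<or> (\<exists>f. distributed M lborel X f \<and>
         (\<forall>a. 0 \<le> a \<and> a \<le> 1/2 \<longrightarrow> f a \<le> f (1 - a))))"

definition u_lin :: "real \<Rightarrow> real \<Rightarrow> nat \<Rightarrow> real" where
  "u_lin \<alpha> m k = sqrt (- ln \<alpha> / (2 * m)) * real k + sqrt (- m * ln \<alpha> / 2)"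

definition u_curv :: "real \<Rightarrow> nat \<Rightarrow> real" where
  "u_curv \<alpha> k = 1.7 * sqrt (real k * (ln (ln (2 * real k)) + 0.72 * ln (5.2 / \<alpha>)))"

fun batch_set :: "(nat \<Rightarrow> real) \<Rightarrow> nat \<Rightarrow> nat \<Rightarrow> nat set" where
  "batch_set q n 0 = {}"
| "batch_set q n (Suc k) =
     insert (LEAST i. i \<in> {1..n} - batch_set q n k \<and>
                      (\<forall>j\<in>{1..n} - batch_set q n k. gmask (q i) \<le> gmask (q j)))
            (batch_set q n k)"

definition batch_rejects :: "(nat \<Rightarrow> real) \<Rightarrow> nat \<Rightarrow> (nat \<Rightarrow> real) \<Rightarrow> bool" where
  "batch_rejects u n q \<longleftrightarrow>
     (\<exists>k\<in>{1..n}. (\<Sum>i\<in>batch_set q n k. hbit (q i)) > u k)"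

definition online_set :: "real \<Rightarrow> (nat \<Rightarrow> real) \<Rightarrow> nat \<Rightarrow> nat set" where
  "online_set c q t = {s \<in> {1..t}. gmask (q s) < c}"

definition online_rejects :: "(nat \<Rightarrow> real) \<Rightarrow> real \<Rightarrow> (nat \<Rightarrow> real) \<Rightarrow> bool" where
  "online_rejects u c q \<longleftrightarrow>
     (\<exists>t\<ge>1. card (online_set c q t) \<ge> 1 \<and>
            (\<Sum>i\<in>online_set c q t. hbit (q i)) > u (card (online_set c q t)))"

end

theory Submission
  imports Defs
begin

text \<open>
  Reflecting a mirror-conservative p-value at 1/2 moves mass towards small values.
  Since both selection rules see only the masked p-values, which are invariant under such
  reflections, and rejection is increasing in the missing bits, every simultaneous reflection of
  a set \<open>B\<close> of coordinates can only raise the rejection probability. Averaging over all \<open>B\<close> and fixing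
  the p-values reduces the claim to counting the fair coin-flip walks that cross the boundary.
  For a line \<open>a + b k\<close> this proportion is at most \<open>exp (-2 a b)\<close>, the Ville bound for the
  exponential supermartingale with parameter \<open>2 b\<close>. The curved boundary dominates a chord on each dyadic
  block, so a union bound over the blocks applies.
\<close>

subsection \<open>Boundary crossing of the fair coin-flip walk\<close>

text \<open>A path is encoded by the set \<open>B\<close> of its up-steps, so the fair-walk
  probability of an event is its cardinality divided by \<open>2 ^ length xs\<close>. The list in
  \<open>crossings\<close> below supplies the time order.\<close>

definition walk :: "'i set \<Rightarrow> 'i set \<Rightarrow> real" where
  "walk B A = (\<Sum>i\<in>A. if i \<in> B then 1 else -1)"

definition crossings :: "(nat \<Rightarrow> real) \<Rightarrow> 'i list \<Rightarrow> 'i set set" where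
  "crossings u xs = {B \<in> Pow (set xs). \<exists>k\<in>{1..length xs}. walk B (set (take k xs)) > u k}"

lemma walk_le_card: "finite A \<Longrightarrow> walk B A \<le> card A"
  unfolding walk_def using sum_mono[of A "\<lambda>i. if i \<in> B then 1 else -1" "\<lambda>i. 1::real"] by simp

text \<open>One-step supermartingale inequality behind the exponential bound, in essence
  \<open>cosh (2 * b) \<le> exp (2 * b^2)\<close>. It is Hoeffding's lemma for a fair variable with
  values \<open>2 * b\<close> and \<open>- 2 * b\<close>, hence range \<open>4 * b\<close>.\<close>

lemma exp_pair_le:
  fixes b :: real
  assumes "0 \<le> b"
  shows "exp (- 2 * b\<^sup>2 - 2 * b) + exp (- 2 * b\<^sup>2 + 2 * b) \<le> 2"
proof -
  have "-(4*b) * (1/2) + ln (1 + 1/2 * (exp (4*b) - 1)) \<le> (4*b)\<^sup>2 / 8"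
    using assms by (intro Hoeffdings_lemma_aux) auto
  then have "ln ((1 + exp (4*b)) / 2) \<le> 2 * b\<^sup>2 + 2 * b"
    by (simp add: field_simps power2_eq_square)
  moreover have "0 < (1 + exp (4*b)) / 2" by (simp add: add_pos_pos)
  ultimately have "(1 + exp (4*b)) / 2 \<le> exp (2 * b\<^sup>2 + 2 * b)"
    using ln_ge_iff by (metis exp_le_cancel_iff exp_ln)
  then have "exp (- (2 * b\<^sup>2 + 2 * b)) * (1 + exp (4*b)) \<le> exp (- (2 * b\<^sup>2 + 2 * b)) * (2 * exp (2 * b\<^sup>2 + 2 * b))"
    by (intro mult_left_mono) auto
  then show ?thesis
    by (simp add: distrib_left exp_minus_inverse flip: exp_add) (simp add: algebra_simps flip: exp_add)
qed

text \<open>The time index starts at 0 so that the induction can shift the intercept after each step;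
  a crossing at time 0 is possible only if the intercept is negative, where the bound exceeds 1.\<close>
lemma card_line_crossings:
  assumes "distinct xs" "0 \<le> b"
  shows "card {B \<in> Pow (set xs). \<exists>k\<le>length xs. walk B (set (take k xs)) > a + b * k}
           \<le> exp (- 2 * a * b) * 2 ^ length xs"
  using assms(1)
proof (induction xs arbitrary: a)
  case Nil
  show ?case
    using assms(2) by (cases "a < 0") (auto simp: walk_def mult_nonpos_nonneg)
next
  case (Cons x xs)
  define c where "c ys a = {B \<in> Pow (set ys). \<exists>k\<le>length ys. walk B (set (take k ys)) > a + b * k}"
    for ys :: "'a list" and a
  have fin: "finite (c ys a)" for ys a by (auto simp: c_def)
  have IH: "card (c xs a) \<le> exp (- 2 * a * b) * 2 ^ length xs" for a
    unfolding c_def using Cons by auto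
  have "card (c (x # xs) a) \<le> exp (- 2 * a * b) * 2 ^ length (x # xs)"
  proof (cases "a < 0")
    case True
    have "card (c (x # xs) a) \<le> card (Pow (set (x # xs)))"
      by (intro card_mono) (auto simp: c_def)
    also have "\<dots> = 2 ^ length (x # xs)"
      using Cons.prems by (simp only: card_Pow List.finite_set distinct_card)
    finally have "real (card (c (x # xs) a)) \<le> 2 ^ length (x # xs)"
      by (metis of_nat_le_iff of_nat_numeral of_nat_power)
    also have "\<dots> \<le> exp (- 2 * a * b) * 2 ^ length (x # xs)"
      using True assms(2) by (auto simp: mult_nonpos_nonneg)
    finally show ?thesis .
  next
    case False
    \<comment> \<open>Case split on the first step: relative to the new position, the line faced by
      the remaining walk has intercept \<open>a + b - 1\<close> after an up-step and
      \<open>a + b + 1\<close> after a down-step. Removing \<open>x\<close> from \<open>B\<close>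
      encodes the remaining path.\<close>
    have "B \<in> c xs (a + b + 1) \<union> insert x ` c xs (a + b - 1)" if B: "B \<in> c (x # xs) a" for B
    proof -
      from B obtain k where k: "k \<le> Suc (length xs)" "walk B (set (take k (x # xs))) > a + b * k"
        and Bs: "B \<subseteq> insert x (set xs)" by (auto simp: c_def)
      have "k \<noteq> 0" using k(2) False by (cases "k = 0") (auto simp: walk_def)
      then obtain l where l: "k = Suc l" by (cases k) auto
      have nx: "x \<notin> set (take l xs)" using Cons.prems by (auto dest: in_set_takeD)
      have eq: "walk B (set (take l xs)) = walk (B - {x}) (set (take l xs))"
        unfolding walk_def using nx by (intro sum.cong) auto
      have "walk B (set (take k (x # xs))) = (if x \<in> B then 1 else -1) + walk (B - {x}) (set (take l xs))"
        unfolding eq[symmetric] using nx l by (simp add: walk_def)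
      with k l have w: "walk (B - {x}) (set (take l xs)) > a + b - (if x \<in> B then 1 else -1) + b * l"
        by (auto simp: algebra_simps)
      show ?thesis
      proof (cases "x \<in> B")
        case True
        with w have "B - {x} \<in> c xs (a + b - 1)" using k l Bs by (auto simp: c_def)
        then show ?thesis using True by (metis UnI2 imageI insert_Diff)
      next
        case False
        with w have "B - {x} \<in> c xs (a + b + 1)" using k l Bs by (auto simp: c_def)
        then show ?thesis using False by auto
      qed
    qed
    then have "card (c (x # xs) a) \<le> card (c xs (a + b + 1) \<union> insert x ` c xs (a + b - 1))"
      by (intro card_mono) (auto simp: fin)
    also have "\<dots> \<le> card (c xs (a + b + 1)) + card (c xs (a + b - 1))"
      by (rule order.trans[OF card_Un_le]) (auto intro: card_image_le fin)
    finally have "real (card (c (x # xs) a)) \<le> real (card (c xs (a + b + 1))) + real (card (c xs (a + b - 1)))"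
      by (simp flip: of_nat_add)
    also have "\<dots> \<le> exp (- 2 * (a + b + 1) * b) * 2 ^ length xs + exp (- 2 * (a + b - 1) * b) * 2 ^ length xs"
      by (intro add_mono IH)
    \<comment> \<open>Factoring out the target bound leaves the two one-step weights, whose sum of
      at most 2 pays for the doubled number of paths.\<close>
    also have "\<dots> = exp (- 2 * a * b) * 2 ^ length xs * (exp (- 2 * b\<^sup>2 - 2 * b) + exp (- 2 * b\<^sup>2 + 2 * b))"
      by (simp add: algebra_simps power2_eq_square flip: exp_add)
    also have "\<dots> \<le> exp (- 2 * a * b) * 2 ^ length xs * 2"
      by (intro mult_left_mono exp_pair_le assms) auto
    finally show ?thesis by simp
  qed
  then show ?case by (simp only: c_def)
qed

lemma card_crossings_line:
  fixes a b :: real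
  assumes "distinct xs" "0 \<le> b" "0 \<le> a"
  shows "card (crossings (\<lambda>k. a + b * k) xs) \<le> exp (- 2 * a * b) * 2 ^ length xs"
proof -
  have "card (crossings (\<lambda>k. a + b * k) xs)
      \<le> card {B \<in> Pow (set xs). \<exists>k\<le>length xs. walk B (set (take k xs)) > a + b * k}"
    by (intro card_mono) (auto simp: crossings_def)
  then show ?thesis
    using card_line_crossings[OF assms(1,2), of a] by linarith
qed

text \<open>Slope times intercept is \<open>- ln \<alpha> / 2\<close> whatever \<open>m\<close> is,
  so the line bound \<open>exp (- 2 * a * b)\<close> is exactly \<open>\<alpha>\<close>.\<close>

lemma card_crossings_u_lin:
  fixes \<alpha> m :: real
  assumes "distinct xs" "0 < \<alpha>" "\<alpha> < 1" "0 < m"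
  shows "card (crossings (u_lin \<alpha> m) xs) \<le> \<alpha> * 2 ^ length xs"
proof -
  define a where "a = sqrt (- m * ln \<alpha> / 2)"
  define b where "b = sqrt (- ln \<alpha> / (2 * m))"
  have ln: "ln \<alpha> < 0" using assms by simp
  have nn: "0 \<le> a" "0 \<le> b"
    using ln assms by (auto simp: a_def b_def mult_nonneg_nonpos divide_nonpos_pos)
  have "a * b = sqrt ((- m * ln \<alpha> / 2) * (- ln \<alpha> / (2 * m)))"
    unfolding a_def b_def by (simp only: real_sqrt_mult)
  also have "(- m * ln \<alpha> / 2) * (- ln \<alpha> / (2 * m)) = (ln \<alpha> / 2)\<^sup>2"
    using assms by (simp add: power2_eq_square)
  finally have "- 2 * a * b = ln \<alpha>" using ln by (simp add: mult.assoc)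
  moreover have "u_lin \<alpha> m = (\<lambda>k. a + b * k)"
    by (auto simp: u_lin_def a_def b_def)
  ultimately show ?thesis
    using card_crossings_line[OF assms(1) nn(2,1)] assms by simp
qed

section \<open>The curved boundary: dyadic chords and the sum of their errors\<close>

text \<open>Comparison with the integral of \<open>x powr (- 1.4)\<close> from 1 to
  \<open>J + 1\<close>. Keeping the subtracted end term makes the induction close; its increment is
  estimated by the mean value theorem.\<close>

lemma inverse_powr_sum_le:
  "(\<Sum>j=1..J. real (j + 1) powr (- 1.4)) \<le> 2.5 * (1 - real (J + 1) powr (- 0.4))"
proof (induction J)
  case (Suc J)
  define x where "x = real (J + 1)"
  have x: "1 \<le> x" by (simp add: x_def)
  have "\<exists>z>x. z < x + 1 \<and> (x + 1) powr (- 0.4) - x powr (- 0.4) = (x + 1 - x) * (- 0.4 * z powr (- 0.4 - 1))"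
    using x by (intro MVT2) (auto intro!: derivative_eq_intros)
  then obtain z where z: "x < z" "z < x + 1"
    "(x + 1) powr (- 0.4) - x powr (- 0.4) = - 0.4 * z powr (- 1.4)" by auto
  have "(x + 1) powr (- 1.4) \<le> z powr (- 1.4)"
    using z x by (intro powr_mono2') auto
  with z Suc show ?case by (simp add: x_def add.commute)
qed simp

text \<open>Two lower bounds combined: \<open>sqrt\<close> is concave, hence above its chord between
  \<open>2 ^ j\<close> and \<open>2 ^ (j + 1)\<close>, and the iterated logarithm is at least its
  value at \<open>k = 2 ^ j\<close>, where \<open>ln (2 * k)\<close> is
  \<open>(j + 1) * ln 2\<close>.\<close>

lemma u_curv_ge_chord:
  fixes k j :: nat and \<alpha> :: real
  defines "L \<equiv> ln (real (j + 1) * ln 2) + 0.72 * ln (5.2 / \<alpha>)"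
  assumes "0 \<le> L" "2 ^ j \<le> k" "k \<le> 2 ^ (j + 1)"
  shows "1.7 * sqrt L * sqrt (2 ^ j) * sqrt 2 / (sqrt 2 + 1) + 1.7 * sqrt L / (sqrt (2 ^ j) * (sqrt 2 + 1)) * k
           \<le> u_curv \<alpha> k"
proof -
  define v where "v = sqrt (2 ^ j :: real)"
  have v: "0 < v" "v\<^sup>2 = 2 ^ j" by (auto simp: v_def)
  have kr: "(2::real) ^ j \<le> k" "real k \<le> 2 ^ j * 2"
    using of_nat_mono[OF assms(3), where ?'a = real] of_nat_mono[OF assms(4), where ?'a = real] by simp_all
  have k0: "0 < real k" using kr(1) by (rule less_le_trans[rotated]) simp
  \<comment> \<open>Expanding this product gives the chord inequality directly, without calculus:
    \<open>sqrt k\<close> lies between the endpoint values \<open>v\<close> and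
    \<open>sqrt 2 * v\<close>.\<close>
  have s: "0 \<le> (sqrt k - v) * (sqrt 2 * v - sqrt k)"
    using kr by (intro mult_nonneg_nonneg) (auto simp: v_def mult.commute simp flip: real_sqrt_mult)
  have "v * v * sqrt 2 + real k \<le> sqrt k * v * (sqrt 2 + 1)"
    using s k0 by (simp add: algebra_simps)
  then have "(v * v * sqrt 2 + real k) / (v * (sqrt 2 + 1)) \<le> sqrt k"
    using v by (subst pos_divide_le_eq) (auto simp: add_pos_pos mult.assoc)
  then have "1.7 * sqrt L * ((v * v * sqrt 2 + real k) / (v * (sqrt 2 + 1))) \<le> 1.7 * sqrt L * sqrt k"
    using assms by (intro mult_left_mono) auto
  moreover have "1.7 * sqrt L * ((v * v * sqrt 2 + real k) / (v * (sqrt 2 + 1)))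
      = 1.7 * sqrt L * v * sqrt 2 / (sqrt 2 + 1) + 1.7 * sqrt L / (v * (sqrt 2 + 1)) * k"
  proof -
    have "(v * v * sqrt 2 + real k) / (v * (sqrt 2 + 1)) = v * sqrt 2 / (sqrt 2 + 1) + k / (v * (sqrt 2 + 1))"
      unfolding add_divide_distrib mult.assoc using v by (subst mult_divide_mult_cancel_left) auto
    then show ?thesis by (simp only: distrib_left times_divide_eq_right times_divide_eq_left mult.assoc)
  qed
  moreover have "1.7 * sqrt L * sqrt k \<le> u_curv \<alpha> k"
  proof -
    have "real (j + 1) * ln 2 = ln (2 ^ (j + 1))" by (subst ln_realpow) auto
    also have "\<dots> \<le> ln (2 * real k)" using kr k0 by (subst ln_le_cancel_iff) auto
    finally have "ln (real (j + 1) * ln 2) \<le> ln (ln (2 * real k))"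
      using ln_gt_zero[of 2] by (subst ln_le_cancel_iff) (auto intro: less_le_trans[rotated])
    then have "k * L \<le> k * (ln (ln (2 * real k)) + 0.72 * ln (5.2 / \<alpha>))"
      unfolding L_def by (intro mult_left_mono) auto
    then show ?thesis unfolding u_curv_def
      by (simp add: mult.commute flip: real_sqrt_mult)
  qed
  ultimately show ?thesis unfolding v_def by (metis order.trans)
qed

lemma ln_5_2_ge: assumes "0 < \<alpha>" "\<alpha> < 1" shows "4/3 \<le> ln (5.2 / \<alpha> :: real)"
proof -
  have "(4::real) \<le> 5.2 / \<alpha>" using assms by (simp add: field_simps)
  then have "ln (2\<^sup>2) \<le> ln (5.2 / \<alpha>)" using assms by (subst ln_le_cancel_iff) auto
  moreover have "ln (2\<^sup>2::real) = 2 * ln 2" by (subst ln_realpow) auto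
  ultimately show ?thesis using ln2_ge_two_thirds by linarith
qed

text \<open>Rules out a crossing after one step, and thereby keeps block \<open>j = 0\<close> out of
  the union bound, whose budget is spent on the blocks \<open>j \<ge> 1\<close>.\<close>

lemma u_curv_1_ge:
  assumes "0 < \<alpha>" "\<alpha> < 1"
  shows "1 \<le> u_curv \<alpha> 1"
proof -
  have "ln (3/2::real) \<le> 1/2" using ln_le_minus_one[of "3/2::real"] by simp
  moreover have "ln (2/3::real) \<le> ln (ln 2)"
    using ln2_ge_two_thirds by (subst ln_le_cancel_iff) auto
  moreover have "ln (2/3::real) = - ln (3/2)" by (simp add: ln_div)
  ultimately have "0.4 \<le> ln (ln 2) + 0.72 * ln (5.2 / \<alpha>)"
    using ln_5_2_ge[OF assms] by (simp add: power2_eq_square)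
  \<comment> \<open>\<open>10/17\<close> is the reciprocal of the factor \<open>1.7\<close>, and its
    square is below \<open>0.4\<close>.\<close>
  then have "sqrt ((10/17)\<^sup>2) \<le> sqrt (ln (ln 2) + 0.72 * ln (5.2 / \<alpha>))"
    by (intro real_sqrt_le_mono) (simp add: power2_eq_square)
  then show ?thesis by (simp add: u_curv_def)
qed

text \<open>In the product of slope and intercept \<open>2 ^ j\<close> cancels, leaving a constant
  slightly above \<open>1.4\<close> times \<open>L\<close>. Then \<open>exp (- 1.4 * L)\<close>
  splits into a summable power of \<open>j + 1\<close>, a power of \<open>ln 2\<close>, and a factor
  at most \<open>\<alpha> / 5.2\<close>.\<close>

lemma exp_chord_le:
  fixes j :: nat and \<alpha> :: real
  defines "L \<equiv> ln (real (j + 1) * ln 2) + 0.72 * ln (5.2 / \<alpha>)"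
  assumes "0 < \<alpha>" "\<alpha> < 1" "1 \<le> j"
  shows "0 \<le> L"
    and "exp (- 2 * (1.7 * sqrt L * sqrt (2 ^ j) * sqrt 2 / (sqrt 2 + 1)) * (1.7 * sqrt L / (sqrt (2 ^ j) * (sqrt 2 + 1))))
           \<le> real (j + 1) powr (- 1.4) * (2 / 5 * \<alpha>)"
proof -
  have ln: "4/3 \<le> ln (5.2 / \<alpha>)" by (rule ln_5_2_ge) fact+
  have "2 * (2/3) \<le> real (j + 1) * ln 2"
    using assms(4) ln2_ge_two_thirds by (intro mult_mono) auto
  then have ln0: "0 \<le> ln (real (j + 1) * ln 2)" by (intro ln_ge_zero) auto
  show L: "0 \<le> L" unfolding L_def using ln ln0 by simp
  define r where "r = sqrt (2::real)"
  have r: "r * r = 2" "0 < r" by (auto simp: r_def)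
  \<comment> \<open>The margin is thin: with \<open>1.414\<close> the constant
    \<open>5.78 * (3 * r - 4)\<close> would drop below \<open>1.4\<close>. Here \<open>5.78\<close>
    is \<open>2 * 1.7^2\<close>, and \<open>3 * r - 4\<close> arises from rationalising
    \<open>r / (r + 1)^2\<close>.\<close>
  have r1: "1.4141 \<le> r" unfolding r_def by (rule real_le_rsqrt) (simp add: power2_eq_square)
  have "(3 * r - 4) * ((r + 1) * (r + 1)) = 3 * (r * r) * r + 2 * (r * r) - 5 * r - 4"
    by (simp add: algebra_simps)
  then have "r = (3 * r - 4) * ((r + 1) * (r + 1))" using r(1) by simp
  moreover have "(r + 1) * (r + 1) \<noteq> 0" using r(2) by simp
  ultimately have "r / ((r + 1) * (r + 1)) = 3 * r - 4" by (metis nonzero_eq_divide_eq)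
  then have eq: "5.78 * r / ((r + 1) * (r + 1)) = 5.78 * (3 * r - 4)"
    by (simp only: times_divide_eq_right[symmetric])
  have e: "1.4 \<le> 5.78 * r / ((r + 1) * (r + 1))" unfolding eq using r1 by simp
  have "2 * (1.7 * sqrt L * sqrt (2 ^ j) * r / (r + 1)) * (1.7 * sqrt L / (sqrt (2 ^ j) * (r + 1)))
      = 5.78 * r / ((r + 1) * (r + 1)) * L"
  proof -
    have "2 * (1.7 * s * v * r / d) * (1.7 * s / (v * d)) = 5.78 * r / (d * d) * (s * s)"
      if "v \<noteq> 0" "d \<noteq> 0" for s v d :: real
      using that by (simp add: field_simps)
    from this[of "sqrt (2 ^ j)" "r + 1" "sqrt L"] show ?thesis
      using L r(2) by simp
  qed
  also have "\<dots> \<ge> 1.4 * L" using L e by (intro mult_right_mono) auto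
  finally have "exp (- 2 * (1.7 * sqrt L * sqrt (2 ^ j) * r / (r + 1)) * (1.7 * sqrt L / (sqrt (2 ^ j) * (r + 1))))
      \<le> exp (- 1.4 * L)" by simp
  \<comment> \<open>\<open>1.4 * 0.72 = 1.008\<close> exceeds 1, so the nonnegative
    \<open>ln (5.2 / \<alpha>)\<close> may be kept with coefficient 1.\<close>
  also have "- 1.4 * L \<le> (- 1.4) * ln (real (j + 1)) + (- 1.4) * ln (ln 2) + - ln (5.2 / \<alpha>)"
  proof -
    define l where "l = ln (5.2 / \<alpha>)"
    have "L = ln (real (j + 1)) + ln (ln 2) + 0.72 * l"
      by (simp add: L_def l_def ln_mult)
    moreover have "0 \<le> l" using ln by (simp add: l_def)
    ultimately show ?thesis unfolding l_def[symmetric] by (simp add: field_simps)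
  qed
  then have "exp (- 1.4 * L) \<le> exp ((- 1.4) * ln (real (j + 1)) + (- 1.4) * ln (ln 2) + - ln (5.2 / \<alpha>))"
    by simp
  also have "\<dots> = real (j + 1) powr (- 1.4) * ln 2 powr (- 1.4) * (\<alpha> / 5.2)"
    using assms(2) by (simp only: exp_add) (simp add: powr_def exp_minus)
  \<comment> \<open>The exponent \<open>1.4\<close> is raised to \<open>3/2\<close> to reach a
    square root that can be estimated; the outcome \<open>3/2 * 1.25 / 5.2\<close> is below
    \<open>2/5\<close>.\<close>
  also have "ln 2 powr (- 1.4) \<le> (2/3) powr (- 1.4 :: real)"
    using ln2_ge_two_thirds by (intro powr_mono2') auto
  also have "\<dots> = (3/2) powr 1.4" by (simp add: powr_minus_divide powr_divide)
  also have "\<dots> \<le> (3/2) powr (1 + 1/2 :: real)" by (intro powr_mono) auto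
  also have "\<dots> = 3/2 * sqrt (3/2)" by (subst powr_add) (simp add: powr_half_sqrt)
  also have "sqrt (3/2) \<le> (1.25::real)" by (rule real_le_lsqrt) (auto simp: power2_eq_square)
  finally have "exp (- 2 * (1.7 * sqrt L * sqrt (2 ^ j) * r / (r + 1)) * (1.7 * sqrt L / (sqrt (2 ^ j) * (r + 1))))
      \<le> real (j + 1) powr (- 1.4) * (3/2 * 1.25) * (\<alpha> / 5.2)"
    using assms(2) by (simp add: mult_left_mono mult_right_mono)
  also have "\<dots> = real (j + 1) powr (- 1.4) * (3/2 * 1.25 * (\<alpha> / 5.2))" by simp
  also have "\<dots> \<le> real (j + 1) powr (- 1.4) * (2 / 5 * \<alpha>)"
    using assms(2) by (intro mult_left_mono) auto
  finally show "exp (- 2 * (1.7 * sqrt L * sqrt (2 ^ j) * sqrt 2 / (sqrt 2 + 1)) * (1.7 * sqrt L / (sqrt (2 ^ j) * (sqrt 2 + 1))))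
           \<le> real (j + 1) powr (- 1.4) * (2 / 5 * \<alpha>)"
    by (simp add: r_def)
qed

text \<open>No crossing is possible at \<open>k = 1\<close>. Each dyadic block \<open>[2^j, 2^(j+1)]\<close>, \<open>j \<ge> 1\<close>, is
  covered by the chord of the square root over that block; the resulting errors sum to at most
  \<open>2.5 * 2/5 * \<alpha>\<close>.\<close>
lemma card_crossings_u_curv:
  fixes \<alpha> :: real
  assumes "distinct xs" "0 < \<alpha>" "\<alpha> < 1"
  shows "card (crossings (u_curv \<alpha>) xs) \<le> \<alpha> * 2 ^ length xs"
proof -
  define n where "n = length xs"
  define L where "L j = ln (real (j + 1) * ln 2) + 0.72 * ln (5.2 / \<alpha>)" for j :: nat
  define a where "a j = 1.7 * sqrt (L j) * sqrt (2 ^ j) * sqrt 2 / (sqrt 2 + 1)" for j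
  define b where "b j = 1.7 * sqrt (L j) / (sqrt (2 ^ j) * (sqrt 2 + 1))" for j
  have L0: "0 \<le> L j" if "1 \<le> j" for j
    unfolding L_def using exp_chord_le(1)[OF assms(2,3) that] .
  have nn: "0 \<le> a j" "0 \<le> b j" if "1 \<le> j" for j
    using L0[OF that] by (auto simp: a_def b_def)
  have "crossings (u_curv \<alpha>) xs \<subseteq> (\<Union>j\<in>{1..n}. crossings (\<lambda>k. a j + b j * k) xs)"
  proof
    fix B assume B: "B \<in> crossings (u_curv \<alpha>) xs"
    then obtain k where k: "1 \<le> k" "k \<le> n" "walk B (set (take k xs)) > u_curv \<alpha> k"
      by (auto simp: crossings_def n_def)
    have "walk B (set (take k xs)) \<le> k"
      using walk_le_card[of "set (take k xs)" B] assms(1) k(2) by (simp add: distinct_card n_def)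
    then have "k \<noteq> 1" using k(3) u_curv_1_ge[OF assms(2,3)] by auto
    then have k2: "2 \<le> k" using k(1) by simp
    obtain j where j: "2 ^ j \<le> k" "k < 2 ^ (j + 1)"
      using ex_power_ivl1[of 2 k] k(1) by auto
    have "j \<noteq> 0" using j k2 by (cases j) auto
    then have j1: "1 \<le> j" by simp
    \<comment> \<open>The range \<open>{1..n}\<close> of blocks is crude, but the error series is
      bounded uniformly in \<open>n\<close>.\<close>
    have "j \<le> n" using less_exp[of j] j(1) k(2) by linarith
    moreover have "a j + b j * k \<le> u_curv \<alpha> k"
      unfolding a_def b_def L_def
      by (rule u_curv_ge_chord) (use L0[OF j1] j in \<open>auto simp: L_def\<close>)
    ultimately show "B \<in> (\<Union>j\<in>{1..n}. crossings (\<lambda>k. a j + b j * k) xs)"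
      using B k j1 unfolding crossings_def by (force simp: n_def)
  qed
  then have "card (crossings (u_curv \<alpha>) xs) \<le> card (\<Union>j\<in>{1..n}. crossings (\<lambda>k. a j + b j * k) xs)"
    by (intro card_mono) (auto simp: crossings_def)
  also have "\<dots> \<le> (\<Sum>j=1..n. card (crossings (\<lambda>k. a j + b j * k) xs))"
    by (rule card_UN_le) simp
  finally have "real (card (crossings (u_curv \<alpha>) xs)) \<le> (\<Sum>j=1..n. real (card (crossings (\<lambda>k. a j + b j * k) xs)))"
    by (simp flip: of_nat_sum)
  also have "\<dots> \<le> (\<Sum>j=1..n. real (j + 1) powr (- 1.4) * (2 / 5 * \<alpha>) * 2 ^ length xs)"
  proof (rule sum_mono)
    fix j assume "j \<in> {1..n}"
    then have j: "1 \<le> j" by simp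
    have "real (card (crossings (\<lambda>k. a j + b j * k) xs)) \<le> exp (- 2 * a j * b j) * 2 ^ length xs"
      by (rule card_crossings_line) (use assms nn j in auto)
    also have "exp (- 2 * a j * b j) \<le> real (j + 1) powr (- 1.4) * (2 / 5 * \<alpha>)"
      unfolding a_def b_def L_def using exp_chord_le(2)[OF assms(2,3) j] by simp
    finally show "real (card (crossings (\<lambda>k. a j + b j * k) xs)) \<le> real (j + 1) powr (- 1.4) * (2 / 5 * \<alpha>) * 2 ^ length xs"
      by simp
  qed
  also have "\<dots> = (\<Sum>j=1..n. real (j + 1) powr (- 1.4)) * (2 / 5 * \<alpha> * 2 ^ length xs)"
    by (simp only: sum_distrib_right mult.assoc)
  also have "\<dots> \<le> 2.5 * (2 / 5 * \<alpha> * 2 ^ length xs)"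
  proof (intro mult_right_mono)
    have "2.5 * (1 - real (n + 1) powr (- 0.4)) \<le> 2.5" by simp
    with inverse_powr_sum_le[of n] show "(\<Sum>j=1..n. real (j + 1) powr (- 1.4)) \<le> 2.5"
      by (rule order.trans)
  qed (use assms(2) in auto)
  finally show ?thesis by simp
qed

section \<open>Nested sets as prefixes of one list\<close>

text \<open>Turns nested selected sets into the successive times of a single walk. The members of
  the chain other than \<open>I\<close> have a union that is again such a member (or empty), so it
  misses some \<open>x\<close> in \<open>I\<close>; this \<open>x\<close> goes last and the rest
  follows by induction.\<close>

lemma ex_list_chain_prefixes:
  assumes "finite I" "\<C> \<subseteq> Pow I" "\<And>A B. A \<in> \<C> \<Longrightarrow> B \<in> \<C> \<Longrightarrow> A \<subseteq> B \<or> B \<subseteq> A"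
  shows "\<exists>xs. distinct xs \<and> set xs = I \<and> (\<forall>A\<in>\<C>. \<exists>k\<le>length xs. A = set (take k xs))"
  using assms
proof (induction I arbitrary: \<C> rule: finite_psubset_induct)
  case (psubset I)
  show ?case
  proof (cases "I = {}")
    case True
    with psubset.prems show ?thesis by (intro exI[of _ "[]"]) auto
  next
    case False
    define \<D> where "\<D> = \<C> - {I}"
    have "\<Union>\<D> \<noteq> I"
    proof (cases "\<D> = {}")
      case False
      have "finite \<D>"
        using psubset.hyps psubset.prems(1) by (metis Diff_subset \<D>_def finite_Pow_iff finite_subset)
      moreover have "A \<union> B \<in> \<D>" if "A \<in> \<D>" "B \<in> \<D>" for A B
        using that psubset.prems(2)[of A B] by (auto simp: \<D>_def Un_absorb1 Un_absorb2)
      ultimately have "\<Union>\<D> \<in> \<D>" using False by (intro finite_Sup_in) auto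
      then show ?thesis by (auto simp: \<D>_def)
    qed (use \<open>I \<noteq> {}\<close> in auto)
    moreover have "\<Union>\<D> \<subseteq> I" using psubset.prems(1) by (auto simp: \<D>_def)
    ultimately obtain x where x: "x \<in> I" "x \<notin> \<Union>\<D>" by auto
    have "\<exists>xs. distinct xs \<and> set xs = I - {x} \<and> (\<forall>A\<in>\<D>. \<exists>k\<le>length xs. A = set (take k xs))"
      using psubset.prems x by (intro psubset.IH) (auto simp: \<D>_def)
    then obtain xs where xs: "distinct xs" "set xs = I - {x}" "\<forall>A\<in>\<D>. \<exists>k\<le>length xs. A = set (take k xs)"
      by blast
    show ?thesis
    proof (intro exI[of _ "xs @ [x]"] conjI ballI)
      fix A assume A: "A \<in> \<C>"
      show "\<exists>k\<le>length (xs @ [x]). A = set (take k (xs @ [x]))"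
      proof (cases "A = I")
        case True
        with xs x show ?thesis by (intro exI[of _ "length (xs @ [x])"]) auto
      next
        case False
        with A xs(3) obtain k where "k \<le> length xs" "A = set (take k xs)" by (auto simp: \<D>_def)
        then show ?thesis by (intro exI[of _ k]) auto
      qed
    qed (use xs x in auto)
  qed
qed

subsection \<open>Reflection of mirror-conservative p-values\<close>

text \<open>The interface between the two halves of the proof: all that the probabilistic argument
  uses about \<open>u\<close>. Quantifying over lists allows any selection order.\<close>

definition walk_boundary :: "(nat \<Rightarrow> real) \<Rightarrow> real \<Rightarrow> bool" where
  "walk_boundary u \<alpha> \<longleftrightarrow>
     (\<forall>xs :: nat list. distinct xs \<longrightarrow> real (card (crossings u xs)) \<le> \<alpha> * 2 ^ length xs)"

definition flip :: "'i set \<Rightarrow> ('i \<Rightarrow> real) \<Rightarrow> 'i \<Rightarrow> real" where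
  "flip B q = (\<lambda>i. if i \<in> B then 1 - q i else q i)"

text \<open>The event-level consequence shared by the discrete and the density form of
  mirror-conservativeness.\<close>

definition mirror_dominated :: "real measure \<Rightarrow> bool" where
  "mirror_dominated \<mu> \<longleftrightarrow>
     (\<forall>E\<in>sets borel. E \<subseteq> {..<1/2} \<longrightarrow> emeasure \<mu> E \<le> emeasure \<mu> ((\<lambda>x. 1 - x) -` E))"

lemma gmask_flip [simp]: "gmask (flip B q i) = gmask (q i)"
  by (auto simp: gmask_def flip_def)

lemma gmask_measurable [measurable]: "gmask \<in> borel_measurable borel"
  unfolding gmask_def by measurable

lemma hbit_measurable [measurable]: "hbit \<in> borel_measurable borel"
  unfolding hbit_def by measurable

text \<open>The pointwise inequality is summed over the countable support in the discrete case and
  integrated in the density case; the substitution \<open>x\<close> to \<open>1 - x\<close> then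
  identifies the right-hand side.\<close>

lemma mirror_conservative_imp_mirror_dominated:
  assumes "prob_space M" and mc: "mirror_conservative M X"
  shows "mirror_dominated (distr M borel X)"
  unfolding mirror_dominated_def
proof (intro ballI impI)
  interpret prob_space M by fact
  fix E :: "real set" assume E[measurable]: "E \<in> sets borel" and sub: "E \<subseteq> {..<1/2}"
  define \<mu> where "\<mu> = distr M borel X"
  \<comment> \<open>The pointwise inequality is available only on \<open>[0, 1/2]\<close>; since
    \<open>X\<close> is nonnegative, the part of \<open>E\<close> below 0 is null.\<close>
  define E' where "E' = E \<inter> {0..}"
  have [measurable]: "E' \<in> sets borel" by (simp add: E'_def)
  have [measurable_cong, simp]: "sets \<mu> = sets borel" by (simp add: \<mu>_def)
  have X[measurable]: "X \<in> borel_measurable M" and X01: "\<And>\<omega>. \<omega> \<in> space M \<Longrightarrow> 0 \<le> X \<omega>"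
    using mc by (auto simp: mirror_conservative_def)
  have "AE x in \<mu>. 0 \<le> x"
    unfolding \<mu>_def by (subst AE_distr_iff) (auto intro!: AE_I2 X01)
  then have EE: "emeasure \<mu> E = emeasure \<mu> E'"
    by (intro emeasure_eq_AE) (auto simp: E'_def)
  have vm[measurable]: "(\<lambda>x::real. 1 - x) -` F \<in> sets borel" if "F \<in> sets borel" for F
    using measurable_sets_borel[of "\<lambda>x::real. 1 - x" borel F] that by simp
  consider (discrete) S where "countable S" "AE \<omega> in M. X \<omega> \<in> S"
      "\<And>a. 0 \<le> a \<and> a \<le> 1/2 \<Longrightarrow> measure M {\<omega>\<in>space M. X \<omega> = a} \<le> measure M {\<omega>\<in>space M. X \<omega> = 1 - a}"
    | (density) f where "distributed M lborel X f" "\<And>a. 0 \<le> a \<and> a \<le> 1/2 \<Longrightarrow> f a \<le> f (1 - a)"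
    using mc unfolding mirror_conservative_def by blast
  then have "emeasure \<mu> E' \<le> emeasure \<mu> ((\<lambda>x. 1 - x) -` E')"
  proof cases
    case discrete
    have single: "emeasure \<mu> {y} = measure M {\<omega> \<in> space M. X \<omega> = y}" for y
    proof -
      have "emeasure \<mu> {y} = emeasure M (X -` {y} \<inter> space M)"
        unfolding \<mu>_def by (rule emeasure_distr) auto
      also have "X -` {y} \<inter> space M = {\<omega> \<in> space M. X \<omega> = y}" by auto
      finally show ?thesis by (simp add: emeasure_eq_measure)
    qed
    have S: "S' \<in> sets borel" if "S' \<subseteq> S" for S'
      by (rule sets.countable) (use countable_subset[OF that discrete(1)] in auto)
    have "AE x in \<mu>. x \<in> S"
      unfolding \<mu>_def using discrete(2) S by (subst AE_distr_iff) auto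
    then have "emeasure \<mu> E' = emeasure \<mu> (E' \<inter> S)"
      using S by (intro emeasure_eq_AE) auto
    also have "\<dots> = (\<integral>\<^sup>+x. emeasure \<mu> {x} \<partial>count_space (E' \<inter> S))"
      using discrete(1) by (intro emeasure_countable_singleton) auto
    also have "\<dots> \<le> (\<integral>\<^sup>+x. emeasure \<mu> {1 - x} \<partial>count_space (E' \<inter> S))"
    proof (intro nn_integral_mono)
      fix x assume "x \<in> space (count_space (E' \<inter> S))"
      then have "0 \<le> x \<and> x \<le> 1/2" using sub by (auto simp: E'_def less_imp_le)
      from discrete(3)[OF this] show "emeasure \<mu> {x} \<le> emeasure \<mu> {1 - x}"
        by (simp add: single)
    qed
    also have "\<dots> = (\<integral>\<^sup>+x. emeasure \<mu> {x} \<partial>count_space ((\<lambda>x. 1 - x) ` (E' \<inter> S)))"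
      by (rule nn_integral_bij_count_space) (auto simp: bij_betw_def inj_on_def)
    also have "\<dots> = emeasure \<mu> ((\<lambda>x. 1 - x) ` (E' \<inter> S))"
      using discrete(1) by (intro emeasure_countable_singleton[symmetric]) auto
    also have "\<dots> \<le> emeasure \<mu> ((\<lambda>x. 1 - x) -` E')"
      by (intro emeasure_mono) auto
    finally show ?thesis .
  next
    case density
    have f[measurable]: "f \<in> borel_measurable borel"
      using distributed_borel_measurable[OF density(1)] by simp
    have "\<mu> = distr M lborel X" unfolding \<mu>_def by (intro distr_cong) auto
    then have \<mu>: "\<mu> = density lborel f"
      using distributed_distr_eq_density[OF density(1)] by simp
    have "emeasure \<mu> E' = (\<integral>\<^sup>+x. f x * indicator E' x \<partial>lborel)"
      by (simp add: \<mu> emeasure_density)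
    also have "\<dots> \<le> (\<integral>\<^sup>+x. f (1 - x) * indicator E' x \<partial>lborel)"
      using density(2) sub by (intro nn_integral_mono) (auto simp: E'_def less_imp_le split: split_indicator)
    also have "\<dots> = (\<integral>\<^sup>+x. f x * indicator ((\<lambda>x. 1 - x) -` E') x \<partial>lborel)"
      using nn_integral_real_affine[of "\<lambda>x. f x * indicator ((\<lambda>x. 1 - x) -` E') x" "-1" 1]
      by (simp add: indicator_def)
    also have "\<dots> = emeasure \<mu> ((\<lambda>x. 1 - x) -` E')"
      by (simp add: \<mu> emeasure_density)
    finally show ?thesis .
  qed
  also have "\<dots> \<le> emeasure \<mu> ((\<lambda>x. 1 - x) -` E)"
    by (intro emeasure_mono) (auto simp: E'_def)
  finally show "emeasure (distr M borel X) E \<le> emeasure (distr M borel X) ((\<lambda>x. 1 - x) -` E)"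
    using EE by (simp add: \<mu>_def)
qed

text \<open>The common part of \<open>G\<close> and its reflection \<open>G'\<close> cancels. The
  rest, \<open>G - G'\<close>, lies below \<open>1/2\<close>: a larger point of \<open>G\<close> has
  its reflection in \<open>G\<close> by \<open>up\<close>, and \<open>1/2\<close> is its own
  reflection. Domination then compares \<open>G - G'\<close> with its mirror image
  \<open>G' - G\<close>.\<close>

lemma mirror_dominated_mono:
  assumes "mirror_dominated \<mu>" and \<mu>: "sets \<mu> = sets borel"
    and G: "G \<in> sets borel" and up: "\<And>x. x < 1/2 \<Longrightarrow> 1 - x \<in> G \<Longrightarrow> x \<in> G"
  shows "emeasure \<mu> G \<le> emeasure \<mu> ((\<lambda>x. 1 - x) -` G)"
proof -
  define G' where "G' = (\<lambda>x::real. 1 - x) -` G"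
  have G': "G' \<in> sets borel"
    using G measurable_sets_borel[of "\<lambda>x::real. 1 - x" borel G] by (auto simp: G'_def)
  then have [measurable]: "G \<in> sets \<mu>" "G' \<in> sets \<mu>" using G \<mu> by auto
  have "G - G' \<in> sets borel" using G G' by blast
  moreover  have "x < 1/2" if "x \<in> G - G'" for x
  proof (rule ccontr)
    assume "\<not> x < 1/2"
    then consider "x = 1/2" | "1 - x < 1/2" by linarith
    then show False
    proof cases
      case 1
      with that show False by (simp add: G'_def)
    next
      case 2
      with up[of "1 - x"] that show False by (simp add: G'_def)
    qed
  qed
  ultimately have "emeasure \<mu> (G - G') \<le> emeasure \<mu> ((\<lambda>x. 1 - x) -` (G - G'))"
    using assms(1) unfolding mirror_dominated_def by blast
  also have "(\<lambda>x. 1 - x) -` (G - G') = G' - G" by (auto simp: G'_def)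
  finally have "emeasure \<mu> (G \<inter> G') + emeasure \<mu> (G - G') \<le> emeasure \<mu> (G \<inter> G') + emeasure \<mu> (G' - G)"
    by (rule add_left_mono)
  also have "emeasure \<mu> (G \<inter> G') + emeasure \<mu> (G - G') = emeasure \<mu> G"
    by (subst plus_emeasure) (auto simp: Int_Diff_Un)
  also have "emeasure \<mu> (G \<inter> G') + emeasure \<mu> (G' - G) = emeasure \<mu> G'"
    unfolding Int_commute[of G G'] by (subst plus_emeasure) (auto simp: Int_Diff_Un)
  finally show ?thesis by (simp add: G'_def)
qed

lemma flip_measurable:
  assumes "B \<subseteq> I" "\<And>i. sets (\<mu> i) = sets borel"
  shows "flip B \<in> Pi\<^sub>M I \<mu> \<rightarrow>\<^sub>M Pi\<^sub>M I \<mu>"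
  unfolding flip_def
proof (rule measurable_PiM_single')
  have [measurable_cong]: "sets (\<mu> i) = sets borel" for i by (rule assms)
  show "(\<lambda>q. if i \<in> B then 1 - q i else q i) \<in> Pi\<^sub>M I \<mu> \<rightarrow>\<^sub>M \<mu> i" if "i \<in> I" for i
    using that by measurable
  have "space (\<mu> i) = UNIV" for i using sets_eq_imp_space_eq[OF assms(2)] by simp
  then show "(\<lambda>q i. if i \<in> B then 1 - q i else q i) \<in> space (Pi\<^sub>M I \<mu>) \<rightarrow> (\<Pi>\<^sub>E i\<in>I. space (\<mu> i))"
    using assms(1) by (auto simp: space_PiM PiE_def extensional_def)
qed

text \<open>Reflecting the coordinates in \<open>B\<close> moves mass towards small p-values, so it can
  only raise the probability of an event that is increasing in the missing bits.\<close>
lemma emeasure_le_emeasure_flip: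
  assumes "finite I" "B \<subseteq> I"
    and \<mu>: "\<And>i. prob_space (\<mu> i)" "\<And>i. sets (\<mu> i) = sets borel" "\<And>i. i \<in> I \<Longrightarrow> mirror_dominated (\<mu> i)"
    and R[measurable]: "Measurable.pred (Pi\<^sub>M I \<mu>) R"
    and up: "\<And>q i x. i \<in> I \<Longrightarrow> x < 1/2 \<Longrightarrow> R (q(i := 1 - x)) \<Longrightarrow> R (q(i := x))"
  shows "emeasure (Pi\<^sub>M I \<mu>) {q \<in> space (Pi\<^sub>M I \<mu>). R q}
    \<le> emeasure (Pi\<^sub>M I \<mu>) {q \<in> space (Pi\<^sub>M I \<mu>). R (flip B q)}"
proof -
  interpret P: product_prob_space \<mu>
    by (intro product_prob_spaceI \<mu>)
  have [measurable_cong, simp]: "sets (\<mu> i) = sets borel" for i by (rule \<mu>)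
  have [simp]: "space (\<mu> i) = UNIV" for i using sets_eq_imp_space_eq[OF \<mu>(2)] by simp
  have "finite B" using assms(1,2) finite_subset by auto
  then show ?thesis using assms(2)
  proof (induction B)
    case empty
    then show ?case by (simp add: flip_def)
  next
    case (insert i B)
    define J where "J = I - {i}"
    have J: "I = insert i J" "i \<notin> J" "finite J" using insert.prems assms(1) by (auto simp: J_def)
    have iI: "i \<in> I" using insert.prems by simp
    have [measurable]: "flip B \<in> Pi\<^sub>M I \<mu> \<rightarrow>\<^sub>M Pi\<^sub>M I \<mu>" "flip (insert i B) \<in> Pi\<^sub>M I \<mu> \<rightarrow>\<^sub>M Pi\<^sub>M I \<mu>"
      using insert.prems by (auto intro!: flip_measurable)
    \<comment> \<open>Fubini with coordinate \<open>i\<close> integrated innermost reduces one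
      further reflection to a one-dimensional inequality for \<open>\<mu> i\<close>.\<close>
    have Fub: "emeasure (Pi\<^sub>M I \<mu>) {q \<in> space (Pi\<^sub>M I \<mu>). Q q}
        = (\<integral>\<^sup>+q. emeasure (\<mu> i) {y. Q (q(i := y))} \<partial>Pi\<^sub>M J \<mu>)"
      if [measurable]: "Measurable.pred (Pi\<^sub>M I \<mu>) Q" for Q
    proof -
      have "emeasure (Pi\<^sub>M I \<mu>) {q \<in> space (Pi\<^sub>M I \<mu>). Q q}
          = (\<integral>\<^sup>+q. indicator {q \<in> space (Pi\<^sub>M I \<mu>). Q q} q \<partial>Pi\<^sub>M I \<mu>)"
        by (subst nn_integral_indicator) auto
      also have "\<dots> = (\<integral>\<^sup>+q. (\<integral>\<^sup>+y. indicator {q \<in> space (Pi\<^sub>M I \<mu>). Q q} (q(i := y)) \<partial>\<mu> i) \<partial>Pi\<^sub>M J \<mu>)"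
        using J that unfolding J(1) by (subst P.product_nn_integral_insert) auto
      also have "\<dots> = (\<integral>\<^sup>+q. emeasure (\<mu> i) {y. Q (q(i := y))} \<partial>Pi\<^sub>M J \<mu>)"
      proof (intro nn_integral_cong)
        fix q assume q: "q \<in> space (Pi\<^sub>M J \<mu>)"
        have [measurable]: "(\<lambda>y. q(i := y)) \<in> \<mu> i \<rightarrow>\<^sub>M Pi\<^sub>M I \<mu>"
          using q unfolding J(1) by (rule measurable_component_update) (use J in auto)
        have "{y \<in> space (\<mu> i). Q (q(i := y))} \<in> sets (\<mu> i)" by measurable
        then have "{y. Q (q(i := y))} \<in> sets (\<mu> i)" by simp
        moreover have "q(i := y) \<in> space (Pi\<^sub>M I \<mu>)" for y
          using q J(1) by (auto simp: space_PiM PiE_def extensional_def)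
        then have "(\<lambda>y. indicator {q \<in> space (Pi\<^sub>M I \<mu>). Q q} (q(i := y)) :: ennreal)
            = indicator {y. Q (q(i := y))}"
          by (auto simp: indicator_def fun_eq_iff)
        ultimately show "(\<integral>\<^sup>+y. indicator {q \<in> space (Pi\<^sub>M I \<mu>). Q q} (q(i := y)) \<partial>\<mu> i)
            = emeasure (\<mu> i) {y. Q (q(i := y))}"
          by simp
      qed
      finally show ?thesis .
    qed
    have "emeasure (Pi\<^sub>M I \<mu>) {q \<in> space (Pi\<^sub>M I \<mu>). R q}
        \<le> emeasure (Pi\<^sub>M I \<mu>) {q \<in> space (Pi\<^sub>M I \<mu>). R (flip B q)}"
      using insert.IH insert.prems by simp
    also have "\<dots> = (\<integral>\<^sup>+q. emeasure (\<mu> i) {y. R (flip B (q(i := y)))} \<partial>Pi\<^sub>M J \<mu>)"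
      by (rule Fub) measurable
    also have "\<dots> \<le> (\<integral>\<^sup>+q. emeasure (\<mu> i) {y. R (flip (insert i B) (q(i := y)))} \<partial>Pi\<^sub>M J \<mu>)"
    proof (intro nn_integral_mono)
      fix q assume q: "q \<in> space (Pi\<^sub>M J \<mu>)"
      have [measurable]: "(\<lambda>y. q(i := y)) \<in> \<mu> i \<rightarrow>\<^sub>M Pi\<^sub>M I \<mu>"
        using q unfolding J(1) by (rule measurable_component_update) (use J in auto)
      have "{y \<in> space (\<mu> i). R (flip B (q(i := y)))} \<in> sets (\<mu> i)" by measurable
      then have G: "{y. R (flip B (q(i := y)))} \<in> sets borel" by simp
      \<comment> \<open>As \<open>i \<notin> B\<close>, reflecting \<open>B\<close> commutes with
        setting coordinate \<open>i\<close>, so the monotonicity of \<open>R\<close> passes to the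
        section in that coordinate.\<close>
      have upd: "flip B (q(i := y)) = (flip B q)(i := y)" for y
        using insert.hyps by (auto simp: flip_def)
      have flip_eq: "flip (insert i B) (q(i := y)) = flip B (q(i := 1 - y))" for y
        using insert.hyps by (auto simp: flip_def fun_eq_iff)
      have "emeasure (\<mu> i) {y. R (flip B (q(i := y)))}
          \<le> emeasure (\<mu> i) ((\<lambda>y. 1 - y) -` {y. R (flip B (q(i := y)))})"
      proof (rule mirror_dominated_mono[OF \<mu>(3)[OF iI] \<mu>(2) G])
        fix x :: real assume "x < 1/2" "1 - x \<in> {y. R (flip B (q(i := y)))}"
        then show "x \<in> {y. R (flip B (q(i := y)))}"
          unfolding upd mem_Collect_eq by (rule up[OF iI])
      qed
      also have "(\<lambda>y. 1 - y) -` {y. R (flip B (q(i := y)))} = {y. R (flip (insert i B) (q(i := y)))}"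
        unfolding flip_eq by (rule vimage_Collect_eq)
      finally show "emeasure (\<mu> i) {y. R (flip B (q(i := y)))}
          \<le> emeasure (\<mu> i) {y. R (flip (insert i B) (q(i := y)))}" .
    qed
    also have "\<dots> = emeasure (Pi\<^sub>M I \<mu>) {q \<in> space (Pi\<^sub>M I \<mu>). R (flip (insert i B) q)}"
      by (rule Fub[symmetric]) measurable
    finally show ?case .
  qed
qed

subsection \<open>Selection rules driven by the masked p-values\<close>

text \<open>Common abstraction of both rules: \<open>\<C> q\<close> collects the current sets that
  the procedure runs through. By \<open>masked\<close> it cannot change under reflections. With
  \<open>I\<close> finite, the online rule is treated one horizon at a time.\<close>

locale masked_selection =
  fixes I :: "nat set" and \<C> :: "(nat \<Rightarrow> real) \<Rightarrow> nat set set"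
  assumes finite_I: "finite I"
    and subset_I: "A \<in> \<C> q \<Longrightarrow> A \<subseteq> I"
    and chain: "A \<in> \<C> q \<Longrightarrow> B \<in> \<C> q \<Longrightarrow> A \<subseteq> B \<or> B \<subseteq> A"
    and masked: "(\<And>i. i \<in> I \<Longrightarrow> gmask (q i) = gmask (q' i)) \<Longrightarrow> \<C> q = \<C> q'"
    and pred_mem: "A \<subseteq> I \<Longrightarrow> Measurable.pred (Pi\<^sub>M I (\<lambda>_. borel)) (\<lambda>q. A \<in> \<C> q)"
begin

text \<open>The counter \<open>k\<close> is recovered as \<open>card A\<close>; excluding the empty
  set excludes \<open>k = 0\<close>.\<close>

definition rejects :: "(nat \<Rightarrow> real) \<Rightarrow> (nat \<Rightarrow> real) \<Rightarrow> bool" where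
  "rejects u q \<longleftrightarrow> (\<exists>A\<in>\<C> q. A \<noteq> {} \<and> (\<Sum>i\<in>A. hbit (q i)) > u (card A))"

lemma rejects_restrict: "rejects u (restrict q I) \<longleftrightarrow> rejects u q"
proof -
  have "\<C> (restrict q I) = \<C> q" by (rule masked) simp
  moreover have "(\<Sum>i\<in>A. hbit (restrict q I i)) = (\<Sum>i\<in>A. hbit (q i))" if "A \<in> \<C> q" for A
    using subset_I[OF that] by (intro sum.cong) auto
  ultimately show ?thesis by (auto simp: rejects_def)
qed

lemma pred_rejects: "Measurable.pred (Pi\<^sub>M I (\<lambda>_. borel)) (rejects u)"
proof -
  have eq: "rejects u = (\<lambda>q. \<exists>A\<in>Pow I. A \<in> \<C> q \<and> A \<noteq> {} \<and> u (card A) < (\<Sum>i\<in>A. hbit (q i)))"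
    unfolding rejects_def using subset_I by (intro ext) blast
  have "Measurable.pred (Pi\<^sub>M I (\<lambda>_. borel)) (\<lambda>q. A \<in> \<C> q \<and> A \<noteq> {} \<and> u (card A) < (\<Sum>i\<in>A. hbit (q i)))"
    if A: "A \<in> Pow I" for A
  proof -
    have [measurable]: "Measurable.pred (Pi\<^sub>M I (\<lambda>_. borel)) (\<lambda>q. A \<in> \<C> q)"
      using A by (intro pred_mem) auto
    have "(\<lambda>q. hbit (q i)) \<in> borel_measurable (Pi\<^sub>M I (\<lambda>_. borel))" if "i \<in> A" for i
      using that A by (intro measurable_compose[OF _ hbit_measurable] measurable_component_singleton) auto
    then have [measurable]: "(\<lambda>q. \<Sum>i\<in>A. hbit (q i)) \<in> borel_measurable (Pi\<^sub>M I (\<lambda>_. borel))"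
      by (rule borel_measurable_sum)
    show ?thesis by measurable
  qed
  then show ?thesis
    unfolding eq using finite_I by (intro pred_intros_finite) auto
qed

text \<open>The masked values agree, so the selected sets are the same, while the bit at
  \<open>i\<close> can only go up.\<close>

lemma rejects_up:
  assumes "x < 1/2" "rejects u (q(i := 1 - x))"
  shows "rejects u (q(i := x))"
proof -
  have "\<C> (q(i := 1 - x)) = \<C> (q(i := x))"
    by (rule masked) (auto simp: gmask_def)
  moreover have "(\<Sum>j\<in>A. hbit ((q(i := 1 - x)) j)) \<le> (\<Sum>j\<in>A. hbit ((q(i := x)) j))" for A
    using assms(1) by (intro sum_mono) (auto simp: hbit_def)
  ultimately show ?thesis
    using assms(2) unfolding rejects_def by (auto intro: less_le_trans)
qed

text \<open>For fixed \<open>q\<close> all reflections yield the same chain of sets, so one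
  enumeration of \<open>I\<close> serves them all, and rejecting reflections inject into crossing
  paths.\<close>

lemma card_rejecting_flips:
  fixes \<alpha> :: real
  assumes "walk_boundary u \<alpha>"
  shows "card {B \<in> Pow I. rejects u (flip B q)} \<le> \<alpha> * 2 ^ card I"
proof -
  have mask: "\<C> (flip B q) = \<C> q" for B by (rule masked) simp
  obtain xs where xs: "distinct xs" "set xs = I" "\<forall>A\<in>\<C> q. \<exists>k\<le>length xs. A = set (take k xs)"
    using ex_list_chain_prefixes[of I "\<C> q"] finite_I subset_I chain by (metis PowI subsetI)
  \<comment> \<open>The up-steps after reflecting \<open>B\<close>: the symmetric difference of
    \<open>B\<close> with the indices whose p-value is below \<open>1/2\<close>, hence injective in
    \<open>B\<close>.\<close>
  define T where "T B = {i \<in> I. (i \<in> B) \<noteq> (q i < 1/2)}" for B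
  have "T B \<in> crossings u xs" if B: "B \<subseteq> I" "rejects u (flip B q)" for B
  proof -
    from B(2) obtain A where A: "A \<in> \<C> q" "A \<noteq> {}" "(\<Sum>i\<in>A. hbit (flip B q i)) > u (card A)"
      by (auto simp: rejects_def mask)
    from xs(3) A(1) obtain k where k: "k \<le> length xs" "A = set (take k xs)" by blast
    have "k \<noteq> 0" using A(2) k by (cases k) auto
    \<comment> \<open>Only an inequality: a value \<open>1/2\<close> is fixed by reflection and
      keeps bit \<open>-1\<close>, while \<open>T B\<close> counts an up-step for it when
      \<open>i \<in> B\<close>.\<close>
    have "(\<Sum>i\<in>A. hbit (flip B q i)) \<le> walk (T B) A"
      unfolding walk_def using subset_I[OF A(1)]
      by (intro sum_mono) (auto simp: hbit_def flip_def T_def)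
    moreover have "card A = k" using k xs(1) by (simp add: distinct_card)
    ultimately have "u k < walk (T B) (set (take k xs))" using A(3) k(2) by simp
    then show ?thesis
      using \<open>k \<noteq> 0\<close> k(1) xs(2) by (auto simp: crossings_def T_def intro!: bexI[of _ k])
  qed
  moreover have "inj_on T (Pow I)" by (auto simp: inj_on_def T_def set_eq_iff)
  ultimately have "card {B \<in> Pow I. rejects u (flip B q)} \<le> card (crossings u xs)"
    by (intro card_inj_on_le[of T]) (auto simp: crossings_def intro: inj_on_subset)
  moreover have "real (card (crossings u xs)) \<le> \<alpha> * 2 ^ card I"
    using assms xs distinct_card[OF xs(1)] by (auto simp: walk_boundary_def)
  ultimately show ?thesis by linarith
qed

text \<open>Each of the \<open>2 ^ card I\<close> reflections bounds the rejection probability from above; averaging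
  over them leaves, for every fixed value of the masked p-values, a fair coin-flip walk.\<close>
lemma emeasure_rejects_le:
  assumes wb: "walk_boundary u \<alpha>"
    and \<mu>: "\<And>i. prob_space (\<mu> i)" "\<And>i. sets (\<mu> i) = sets borel" "\<And>i. i \<in> I \<Longrightarrow> mirror_dominated (\<mu> i)"
  shows "emeasure (Pi\<^sub>M I \<mu>) {q \<in> space (Pi\<^sub>M I \<mu>). rejects u q} \<le> \<alpha>"
proof -
  define \<nu> where "\<nu> = Pi\<^sub>M I \<mu>"
  interpret N: prob_space \<nu> unfolding \<nu>_def by (intro prob_space_PiM \<mu>)
  have sets_\<nu>: "sets \<nu> = sets (Pi\<^sub>M I (\<lambda>_. borel))"
    unfolding \<nu>_def by (intro sets_PiM_cong \<mu>) simp
  have [measurable]: "Measurable.pred \<nu> (rejects u)"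
    using pred_rejects by (simp add: measurable_cong_sets[OF sets_\<nu> refl])
  have pred_flip[measurable]: "Measurable.pred \<nu> (\<lambda>q. rejects u (flip B q))" if "B \<subseteq> I" for B
  proof -
    have [measurable]: "flip B \<in> \<nu> \<rightarrow>\<^sub>M \<nu>" unfolding \<nu>_def by (intro flip_measurable \<mu> that)
    show ?thesis by measurable
  qed
  define E where "E = {q \<in> space \<nu>. rejects u q}"
  have "of_nat (card (Pow I)) * emeasure \<nu> E = (\<Sum>B\<in>Pow I. emeasure \<nu> E)" by simp
  also have "\<dots> \<le> (\<Sum>B\<in>Pow I. emeasure \<nu> {q \<in> space \<nu>. rejects u (flip B q)})"
  proof (rule sum_mono)
    fix B assume "B \<in> Pow I"
    then have B: "B \<subseteq> I" by simp
    show "emeasure \<nu> E \<le> emeasure \<nu> {q \<in> space \<nu>. rejects u (flip B q)}"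
      unfolding \<nu>_def E_def
    proof (rule emeasure_le_emeasure_flip[where R = "rejects u", OF finite_I B \<mu>])
      show "Measurable.pred (Pi\<^sub>M I \<mu>) (rejects u)"
        using \<open>Measurable.pred \<nu> (rejects u)\<close> by (simp add: \<nu>_def)
    qed (assumption | rule rejects_up)+
  qed
  also have "\<dots> = (\<Sum>B\<in>Pow I. \<integral>\<^sup>+q. indicator {q \<in> space \<nu>. rejects u (flip B q)} q \<partial>\<nu>)"
    using pred_flip by (intro sum.cong refl nn_integral_indicator[symmetric]) (auto simp: pred_def)
  also have "\<dots> = (\<integral>\<^sup>+q. (\<Sum>B\<in>Pow I. indicator {q \<in> space \<nu>. rejects u (flip B q)} q) \<partial>\<nu>)"
    using pred_flip by (intro nn_integral_sum[symmetric] borel_measurable_indicator) (auto simp: pred_def)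
  also have "\<dots> \<le> (\<integral>\<^sup>+q. ennreal (\<alpha> * 2 ^ card I) \<partial>\<nu>)"
  proof (intro nn_integral_mono)
    fix q assume q: "q \<in> space \<nu>"
    have "(\<Sum>B\<in>Pow I. indicator {q \<in> space \<nu>. rejects u (flip B q)} q)
        = (of_nat (card {B \<in> Pow I. rejects u (flip B q)}) :: ennreal)"
      using finite_I q by (simp add: indicator_def sum.If_cases Int_def)
    also have "\<dots> \<le> ennreal (\<alpha> * 2 ^ card I)"
      using card_rejecting_flips[OF wb, of q] by (simp flip: ennreal_of_nat_eq_real_of_nat add: ennreal_leI)
    finally show "(\<Sum>B\<in>Pow I. indicator {q \<in> space \<nu>. rejects u (flip B q)} q) \<le> ennreal (\<alpha> * 2 ^ card I)" .
  qed
  also have "\<dots> = ennreal (\<alpha> * 2 ^ card I)" by (simp add: N.emeasure_space_1)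
  finally have le: "2 ^ card I * emeasure \<nu> E \<le> ennreal (\<alpha> * 2 ^ card I)"
    using finite_I by (simp add: card_Pow)
  have E: "emeasure \<nu> E = ennreal (measure \<nu> E)"
    by (rule N.emeasure_eq_measure)
  \<comment> \<open>\<open>ennreal\<close> sends negative reals to 0, so the return to real numbers
    requires this sign; it comes from a cardinality bounded by the expression.\<close>
  have "0 \<le> \<alpha> * 2 ^ card I"
    using card_rejecting_flips[OF wb, of undefined] by (rule order.trans[rotated]) simp
  moreover from le have "ennreal (2 ^ card I * measure \<nu> E) \<le> ennreal (\<alpha> * 2 ^ card I)"
    unfolding E by (simp add: ennreal_mult flip: ennreal_power)
  ultimately have "measure \<nu> E \<le> \<alpha>" by (simp add: mult.commute)
  then have "emeasure \<nu> E \<le> ennreal \<alpha>" unfolding E by (rule ennreal_leI)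
  then show ?thesis by (simp add: E_def \<nu>_def)
qed

text \<open>Independence makes the joint law of the p-values on \<open>I\<close> the product of
  their marginals, where the product-space bound applies.\<close>

lemma prob_rejects_le:
  assumes wb: "walk_boundary u \<alpha>" "0 \<le> \<alpha>" and "prob_space M"
    and indep: "prob_space.indep_vars M (\<lambda>_. borel) p I"
    and mc: "\<And>i. i \<in> I \<Longrightarrow> mirror_conservative M (p i)"
  shows "{\<omega> \<in> space M. rejects u (\<lambda>i. p i \<omega>)} \<in> sets M"
    and "measure M {\<omega> \<in> space M. rejects u (\<lambda>i. p i \<omega>)} \<le> \<alpha>"
proof -
  interpret prob_space M by fact
  define P where "P \<omega> = (\<lambda>i\<in>I. p i \<omega>)" for \<omega>
  have p: "i \<in> I \<Longrightarrow> p i \<in> borel_measurable M" for i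
    using mc by (auto simp: mirror_conservative_def)
  have P[measurable]: "P \<in> M \<rightarrow>\<^sub>M Pi\<^sub>M I (\<lambda>_. borel)"
    unfolding P_def by (intro measurable_restrict p)
  note [measurable] = pred_rejects
  have eq: "{\<omega> \<in> space M. rejects u (\<lambda>i. p i \<omega>)} = {\<omega> \<in> space M. rejects u (P \<omega>)}"
    by (simp add: P_def rejects_restrict)
  show meas: "{\<omega> \<in> space M. rejects u (\<lambda>i. p i \<omega>)} \<in> sets M"
    unfolding eq by measurable
  show "measure M {\<omega> \<in> space M. rejects u (\<lambda>i. p i \<omega>)} \<le> \<alpha>"
  proof (cases "I = {}")
    case True
    then have "{\<omega> \<in> space M. rejects u (\<lambda>i. p i \<omega>)} = {}"
      using subset_I by (auto simp: rejects_def)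
    then show ?thesis using wb(2) by (metis measure_empty)
  next
    case False
    \<comment> \<open>The point mass at 0 is a filler outside \<open>I\<close>, so that every
      \<open>\<mu> i\<close> is a probability measure.\<close>
    define \<mu> where "\<mu> i = (if i \<in> I then distr M borel (p i) else return borel 0)" for i
    have \<mu>: "prob_space (\<mu> i)" "sets (\<mu> i) = sets borel" "i \<in> I \<Longrightarrow> mirror_dominated (\<mu> i)" for i
      using mirror_conservative_imp_mirror_dominated[OF \<open>prob_space M\<close> mc]
      by (auto simp: \<mu>_def intro!: prob_space_distr p prob_space_return)
    have "distr M (Pi\<^sub>M I (\<lambda>_. borel)) P = Pi\<^sub>M I (\<lambda>i. distr M borel (p i))"
      unfolding P_def using indep indep_vars_iff_distr_eq_PiM'[OF False p] by simp
    also have "\<dots> = Pi\<^sub>M I \<mu>" by (intro PiM_cong) (auto simp: \<mu>_def)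
    finally have d: "distr M (Pi\<^sub>M I (\<lambda>_. borel)) P = Pi\<^sub>M I \<mu>" .
    have "emeasure M {\<omega> \<in> space M. rejects u (P \<omega>)}
        = emeasure (distr M (Pi\<^sub>M I (\<lambda>_. borel)) P) {q \<in> space (Pi\<^sub>M I (\<lambda>_. borel)). rejects u q}"
      using measurable_space[OF P]
      by (subst emeasure_distr) (auto intro!: arg_cong2[where f = emeasure])
    also have "{q \<in> space (Pi\<^sub>M I (\<lambda>_. borel)). rejects u q} = {q \<in> space (Pi\<^sub>M I \<mu>). rejects u q}"
      using \<mu>(2) by (auto simp: space_PiM sets_eq_imp_space_eq)
    also have "emeasure (distr M (Pi\<^sub>M I (\<lambda>_. borel)) P) \<dots> \<le> \<alpha>"
      unfolding d by (intro emeasure_rejects_le wb \<mu>)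
    finally show ?thesis
      unfolding eq using wb(2) by (simp add: emeasure_eq_measure)
  qed
qed

end

subsection \<open>The batch and online rules\<close>

text \<open>While fewer than \<open>n\<close> indices are chosen, a minimiser remains, so
  \<open>LEAST\<close> returns a genuine new index.\<close>

lemma batch_set_invariant:
  assumes "k \<le> n"
  shows "batch_set q n k \<subseteq> {1..n} \<and> card (batch_set q n k) = k"
  using assms
proof (induction k)
  case (Suc k)
  let ?J = "{1..n} - batch_set q n k"
  have IH: "batch_set q n k \<subseteq> {1..n}" "card (batch_set q n k) = k" using Suc by auto
  have "card ?J = n - k" using IH by (subst card_Diff_subset) (auto intro: finite_subset)
  then have "?J \<noteq> {}" using Suc.prems by (metis Suc_le_lessD card.empty less_irrefl zero_less_diff)
  then have "\<exists>i. i \<in> ?J \<and> (\<forall>j\<in>?J. gmask (q i) \<le> gmask (q j))"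
    using ex_is_arg_min_if_finite[of ?J "\<lambda>i. gmask (q i)"] by (auto simp: is_arg_min_linorder)
  then have "(LEAST i. i \<in> ?J \<and> (\<forall>j\<in>?J. gmask (q i) \<le> gmask (q j))) \<in> ?J"
    by (rule LeastI2_ex) simp
  moreover have "finite (batch_set q n k)" using IH(1) finite_subset by blast
  ultimately show ?case using IH by simp
qed simp

text \<open>Ties are broken by the smallest index, so the order consults nothing beyond the masked
  p-values.\<close>

lemma batch_set_masked:
  assumes "\<And>i. i \<in> {1..n} \<Longrightarrow> gmask (q i) = gmask (q' i)"
  shows "batch_set q n k = batch_set q' n k"
proof (induction k)
  case (Suc k)
  show ?case
    unfolding batch_set.simps Suc
    by (intro arg_cong2[where f = insert] refl arg_cong[where f = Least] ext) (auto simp: assms)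
qed simp

lemma batch_set_mono: "k \<le> l \<Longrightarrow> batch_set q n k \<subseteq> batch_set q n l"
  by (induction l rule: dec_induct) auto

lemma pred_batch_set:
  assumes "k \<le> n"
  shows "Measurable.pred (Pi\<^sub>M {1..n} (\<lambda>_. borel)) (\<lambda>q. batch_set q n k = A)"
  using assms
proof (induction k arbitrary: A)
  case (Suc k)
  let ?P = "Pi\<^sub>M {1..n} (\<lambda>_. borel :: real measure)"
  define m where "m B q = (LEAST i. i \<in> {1..n} - B \<and> (\<forall>j\<in>{1..n} - B. gmask (q i) \<le> gmask (q j)))"
    for B and q :: "nat \<Rightarrow> real"
  have m: "m B \<in> ?P \<rightarrow>\<^sub>M count_space UNIV" for B
    unfolding m_def
  proof (rule measurable_Least)
    fix i
    show "Measurable.pred ?P (\<lambda>q. i \<in> {1..n} - B \<and> (\<forall>j\<in>{1..n} - B. gmask (q i) \<le> gmask (q j)))"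
    proof (cases "i \<in> {1..n} - B")
      case True
      have "Measurable.pred ?P (\<lambda>q. \<forall>j\<in>{1..n} - B. gmask (q i) \<le> gmask (q j))"
      proof (intro pred_intros_finite)
        fix j assume "j \<in> {1..n} - B"
        then have "(\<lambda>q. gmask (q i)) \<in> borel_measurable ?P" "(\<lambda>q. gmask (q j)) \<in> borel_measurable ?P"
          using True by (auto intro!: measurable_compose[OF _ gmask_measurable] measurable_component_singleton)
        then show "Measurable.pred ?P (\<lambda>q. gmask (q i) \<le> gmask (q j))"
          unfolding pred_def by (rule borel_measurable_le)
      qed simp
      then show ?thesis using True by (intro pred_intros_logic) auto
    next
      case False
      then have eq: "(\<lambda>q. i \<in> {1..n} - B \<and> (\<forall>j\<in>{1..n} - B. gmask (q i) \<le> gmask (q j))) = (\<lambda>_. False)"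
        by blast
      show ?thesis unfolding eq by (rule measurable_const) simp
    qed
  qed
  \<comment> \<open>Split over the finitely many values \<open>B\<close> of the previous set; for
    fixed \<open>B\<close> the next index is measurable in \<open>q\<close>.\<close>
  have eq: "batch_set q n (Suc k) = A \<longleftrightarrow>
      (\<exists>B\<in>Pow {1..n}. batch_set q n k = B \<and> insert (m B q) B = A)" for q
  proof -
    have "batch_set q n (Suc k) = insert (m (batch_set q n k) q) (batch_set q n k)"
      unfolding m_def by (rule batch_set.simps)
    moreover have "batch_set q n k \<in> Pow {1..n}"
      using batch_set_invariant[of k n q] Suc.prems by simp
    ultimately show ?thesis by blast
  qed
  have "Measurable.pred ?P (\<lambda>q. batch_set q n k = B \<and> insert (m B q) B = A)" for B
    using Suc.prems by (intro pred_intros_logic Suc.IH measurable_compose[OF m]) auto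
  then show ?case unfolding eq by (intro pred_intros_finite) auto
qed simp

lemma masked_selection_batch:
  "masked_selection {1..n} (\<lambda>q. batch_set q n ` {0..n})"
proof
  fix q A B assume "A \<in> batch_set q n ` {0..n}" "B \<in> batch_set q n ` {0..n}"
  then obtain k l where "A = batch_set q n k" "B = batch_set q n l" by auto
  then show "A \<subseteq> B \<or> B \<subseteq> A" using batch_set_mono by (metis nat_le_linear)
next
  fix q q' :: "nat \<Rightarrow> real" assume "\<And>i. i \<in> {1..n} \<Longrightarrow> gmask (q i) = gmask (q' i)"
  then have "batch_set q n = batch_set q' n" by (intro ext batch_set_masked)
  then show "batch_set q n ` {0..n} = batch_set q' n ` {0..n}" by simp
next
  fix A :: "nat set"
  have "(\<lambda>q. A \<in> batch_set q n ` {0..n}) = (\<lambda>q. \<exists>k\<in>{0..n}. batch_set q n k = A)" by auto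
  moreover have "Measurable.pred (Pi\<^sub>M {1..n} (\<lambda>_. borel)) \<dots>"
    by (intro pred_intros_finite pred_batch_set) auto
  ultimately show "Measurable.pred (Pi\<^sub>M {1..n} (\<lambda>_. borel)) (\<lambda>q. A \<in> batch_set q n ` {0..n})"
    by simp
next
  fix q A assume "A \<in> batch_set q n ` {0..n}"
  then show "A \<subseteq> {1..n}" using batch_set_invariant by (metis atLeastAtMost_iff imageE)
qed simp

text \<open>Step \<open>k\<close> produces a set of exactly \<open>k\<close> elements, so
  \<open>u (card A)\<close> is \<open>u k\<close>; index 0 contributes only the empty set, which
  \<open>rejects\<close> discards.\<close>

lemma batch_rejects_iff:
  "batch_rejects u n q \<longleftrightarrow> masked_selection.rejects (\<lambda>q. batch_set q n ` {0..n}) u q"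
proof -
  have "batch_set q n k \<noteq> {} \<longleftrightarrow> 1 \<le> k" "card (batch_set q n k) = k" if "k \<le> n" for k
    using batch_set_invariant[OF that, of q] finite_subset[of "batch_set q n k" "{1..n}"]
    by (auto simp: Suc_le_eq card_gt_0_iff)
  then show ?thesis
    unfolding batch_rejects_def masked_selection.rejects_def[OF masked_selection_batch] by force
qed

lemma masked_selection_online:
  "masked_selection {1..N} (\<lambda>q. online_set c q ` {0..N})"
proof
  fix q A B assume "A \<in> online_set c q ` {0..N}" "B \<in> online_set c q ` {0..N}"
  then show "A \<subseteq> B \<or> B \<subseteq> A" by (auto simp: online_set_def)
next
  fix q q' :: "nat \<Rightarrow> real" assume "\<And>i. i \<in> {1..N} \<Longrightarrow> gmask (q i) = gmask (q' i)"
  then have "online_set c q t = online_set c q' t" if "t \<in> {0..N}" for t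
    using that by (auto simp: online_set_def)
  then show "online_set c q ` {0..N} = online_set c q' ` {0..N}" by (intro image_cong) auto
next
  fix A assume A: "A \<subseteq> {1..N}"
  let ?P = "Pi\<^sub>M {1..N} (\<lambda>_. borel :: real measure)"
  \<comment> \<open>This form is a finite Boolean combination of the events
    \<open>gmask (q s) < c\<close>, hence measurable.\<close>
  have "A \<in> online_set c q ` {0..N} \<longleftrightarrow>
      (\<exists>t\<in>{0..N}. \<forall>s\<in>{1..N}. (s \<le> t \<and> gmask (q s) < c) = (s \<in> A))" for q
    using A unfolding online_set_def image_iff by (intro bex_cong refl) (fastforce simp: set_eq_iff)
  moreover have "Measurable.pred ?P (\<lambda>q. \<exists>t\<in>{0..N}. \<forall>s\<in>{1..N}. (s \<le> t \<and> gmask (q s) < c) = (s \<in> A))"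
    by measurable
  ultimately show "Measurable.pred ?P (\<lambda>q. A \<in> online_set c q ` {0..N})" by simp
qed (auto simp: online_set_def)

text \<open>A rejection happens at some finite time, so it is already visible at a finite horizon
  \<open>N\<close>.\<close>

lemma online_rejects_iff:
  "online_rejects u c q \<longleftrightarrow> (\<exists>N. masked_selection.rejects (\<lambda>q. online_set c q ` {0..N}) u q)"
  (is "?L \<longleftrightarrow> ?R")
proof -
  have card: "card (online_set c q t) \<ge> 1 \<longleftrightarrow> online_set c q t \<noteq> {}" for t
    by (simp add: Suc_le_eq card_gt_0_iff online_set_def)
  have "?R \<longleftrightarrow> (\<exists>t. online_set c q t \<noteq> {} \<and>
      (\<Sum>i\<in>online_set c q t. hbit (q i)) > u (card (online_set c q t)))"
    unfolding masked_selection.rejects_def[OF masked_selection_online] by fastforce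
  moreover have "t \<ge> 1" if "online_set c q t \<noteq> {}" for t
    using that by (cases t) (auto simp: online_set_def)
  ultimately show ?thesis
    unfolding online_rejects_def card by blast
qed

text \<open>The boundary is prescribed only for \<open>k \<ge> 1\<close>, and
  \<open>crossings\<close> evaluates it only there.\<close>

lemma walk_boundary_cong:
  assumes "\<And>k. 1 \<le> k \<Longrightarrow> u k = v k"
  shows "walk_boundary u \<alpha> \<longleftrightarrow> walk_boundary v \<alpha>"
proof -
  have "crossings u xs = crossings v xs" for xs :: "nat list"
    using assms by (auto simp: crossings_def)
  then show ?thesis by (simp add: walk_boundary_def)
qed

theorem theorem2:
  fixes \<alpha> :: real and u :: "nat \<Rightarrow> real"
  assumes "0 < \<alpha>" and "\<alpha> < 1"
    and "(\<exists>m>0. \<forall>k\<ge>1. u k = u_lin \<alpha> m k) \<or> (\<forall>k\<ge>1. u k = u_curv \<alpha> k)"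
  shows "(\<forall>(M :: 'a measure) (p :: nat \<Rightarrow> 'a \<Rightarrow> real) (n :: nat).
           prob_space M \<and> prob_space.indep_vars M (\<lambda>_. borel) p {1..n} \<and>
           (\<forall>i\<in>{1..n}. mirror_conservative M (p i)) \<longrightarrow>
           {\<omega> \<in> space M. batch_rejects u n (\<lambda>i. p i \<omega>)} \<in> sets M \<and>
           measure M {\<omega> \<in> space M. batch_rejects u n (\<lambda>i. p i \<omega>)} \<le> \<alpha>) \<and>
         (\<forall>(M :: 'a measure) (p :: nat \<Rightarrow> 'a \<Rightarrow> real) (c :: real).
           prob_space M \<and> prob_space.indep_vars M (\<lambda>_. borel) p {1..} \<and>
           (\<forall>i\<in>{1..}. mirror_conservative M (p i)) \<longrightarrow>
           {\<omega> \<in> space M. online_rejects u c (\<lambda>i. p i \<omega>)} \<in> sets M \<and>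
           measure M {\<omega> \<in> space M. online_rejects u c (\<lambda>i. p i \<omega>)} \<le> \<alpha>)"
proof (intro conjI allI impI; elim conjE)
  have wb: "walk_boundary u \<alpha>"
    using assms(3)
  proof
    assume "\<exists>m>0. \<forall>k\<ge>1. u k = u_lin \<alpha> m k"
    then obtain m where m: "0 < m" "\<And>k. 1 \<le> k \<Longrightarrow> u k = u_lin \<alpha> m k" by auto
    then have "walk_boundary (u_lin \<alpha> m) \<alpha>"
      using card_crossings_u_lin assms(1,2) by (auto simp: walk_boundary_def)
    then show ?thesis using walk_boundary_cong[of u "u_lin \<alpha> m"] m(2) by simp
  next
    assume u: "\<forall>k\<ge>1. u k = u_curv \<alpha> k"
    have "walk_boundary (u_curv \<alpha>) \<alpha>"
      using card_crossings_u_curv assms(1,2) by (auto simp: walk_boundary_def)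
    then show ?thesis using walk_boundary_cong[of u "u_curv \<alpha>"] u by simp
  qed
  {
    fix M :: "'a measure" and p :: "nat \<Rightarrow> 'a \<Rightarrow> real" and n :: nat
    assume M: "prob_space M" "prob_space.indep_vars M (\<lambda>_. borel) p {1..n}"
      "\<forall>i\<in>{1..n}. mirror_conservative M (p i)"
    interpret masked_selection "{1..n}" "\<lambda>q. batch_set q n ` {0..n}"
      by (rule masked_selection_batch)
    show "{\<omega> \<in> space M. batch_rejects u n (\<lambda>i. p i \<omega>)} \<in> sets M"
      "measure M {\<omega> \<in> space M. batch_rejects u n (\<lambda>i. p i \<omega>)} \<le> \<alpha>"
      unfolding batch_rejects_iff using prob_rejects_le[OF wb _ M(1,2)] M(3) assms(1) by auto
  next
    fix M :: "'a measure" and p :: "nat \<Rightarrow> 'a \<Rightarrow> real" and c :: real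
    assume M: "prob_space M" "prob_space.indep_vars M (\<lambda>_. borel) p {1..}"
      "\<forall>i\<in>{1..}. mirror_conservative M (p i)"
    interpret prob_space M by fact
    define E where "E N = {\<omega> \<in> space M.
      masked_selection.rejects (\<lambda>q. online_set c q ` {0..N}) u (\<lambda>i. p i \<omega>)}" for N
    have E: "E N \<in> sets M" "measure M (E N) \<le> \<alpha>" for N
    proof -
      interpret masked_selection "{1..N}" "\<lambda>q. online_set c q ` {0..N}"
        by (rule masked_selection_online)
      have "indep_vars (\<lambda>_. borel) p {1..N}" using M(2) by (rule indep_vars_subset) auto
      from prob_rejects_le[OF wb _ M(1) this] M(3) assms(1)
      show "E N \<in> sets M" "measure M (E N) \<le> \<alpha>" by (auto simp: E_def)
    qed
    have eq: "{\<omega> \<in> space M. online_rejects u c (\<lambda>i. p i \<omega>)} = (\<Union>N. E N)"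
      by (auto simp: E_def online_rejects_iff)
    show "{\<omega> \<in> space M. online_rejects u c (\<lambda>i. p i \<omega>)} \<in> sets M"
      unfolding eq using E(1) by auto
    \<comment> \<open>A longer horizon only adds candidate sets, so the events increase, and
      continuity from below carries the uniform bound \<open>\<alpha>\<close> to the infinite
      horizon.\<close>
    have "incseq E"
      unfolding incseq_def E_def masked_selection.rejects_def[OF masked_selection_online]
      by (fastforce intro: order.trans)
    then have "(\<lambda>N. measure M (E N)) \<longlonglongrightarrow> measure M (\<Union>N. E N)"
      using E(1) by (intro finite_Lim_measure_incseq) auto
    then show "measure M {\<omega> \<in> space M. online_rejects u c (\<lambda>i. p i \<omega>)} \<le> \<alpha>"
      unfolding eq using E(2) by (intro LIMSEQ_le_const2) auto
  }
qed

end
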